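(* Let $\mathcal{H}$ be a complex Hilbert space and let $T\in\mathcal{L}^h\setminus\mathcal{L}^+$ be an operator with closed range. Then the projection proper splitting of $T$ does not converge.
   Context: $\mathcal{L}(\mathcal{H})$ is the algebra of bounded linear operators on $\mathcal{H}$; $\mathcal{L}^h$ and $\mathcal{L}^+$ are the sets of selfadjoint and positive (semidefinite) operators in it; $\rho(\cdot)$ is the spectral radius; $P_T$ is the orthogonal projection onto $\overline{\mathcal{R}(T)}$; $U^\dagger$ is the Moore-Penrose inverse of a closed range operator $U$. A proper splitting of $T$ is a decomposition $T=U-V$ with $U,V\in\mathcal{L}(\mathcal{H})$ such that $U$ has the same range and nullspace as $T$; it converges if $\rho(U^\dagger V)<1$. The projection proper splitting of a normal closed range operator $T$ is $T=P_T-V$, i.e. $U=P_T$ and $V=P_T-T$. *)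

theory Defs
  imports "HOL-Analysis.Analysis"
begin

text \<open>
  The library has real but no complex inner product spaces.  A complex inner product space is
  introduced as a space of class \<open>real_inner\<close> (which supplies norm, metric and topology) together
  with a complex scalar multiplication extending the real one and a sesquilinear form, linear in
  the first argument, whose real part is the real inner product.  As
  \<open>Re \<langle>x, x\<rangle> = x \<bullet> x\<close>, the form is positive definite and induces the norm of the space.
\<close>

class complex_inner = real_inner +
  fixes scaleC :: "complex \<Rightarrow> 'a \<Rightarrow> 'a"  (infixr "*\<^sub>C" 75)
    and cinner :: "'a \<Rightarrow> 'a \<Rightarrow> complex"
  assumes scaleC_add_right: "c *\<^sub>C (x + y) = c *\<^sub>C x + c *\<^sub>C y"
    and scaleC_add_left: "(c + d) *\<^sub>C x = c *\<^sub>C x + d *\<^sub>C x"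
    and scaleC_scaleC: "c *\<^sub>C (d *\<^sub>C x) = (c * d) *\<^sub>C x"
    and scaleC_of_real: "complex_of_real r *\<^sub>C x = r *\<^sub>R x"
    and cinner_commute: "cinner x y = cnj (cinner y x)"
    and cinner_add_left: "cinner (x + y) z = cinner x z + cinner y z"
    and cinner_scaleC_left: "cinner (c *\<^sub>C x) y = c * cinner x y"
    and Re_cinner: "Re (cinner x y) = x \<bullet> y"

class complex_hilbert = complex_inner + banach

instantiation complex :: complex_hilbert
begin

definition scaleC_complex :: "complex \<Rightarrow> complex \<Rightarrow> complex"
  where "scaleC_complex c z = c * z"

definition cinner_complex :: "complex \<Rightarrow> complex \<Rightarrow> complex"
  where "cinner_complex w z = w * cnj z"

instance
  by standard
    (auto simp: scaleC_complex_def cinner_complex_def algebra_simps inner_complex_def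
      scaleR_conv_of_real)

end

subsection \<open>Bounded operators\<close>

definition bounded_clinear :: "('a::complex_inner \<Rightarrow> 'a) \<Rightarrow> bool"
  where "bounded_clinear T \<longleftrightarrow> bounded_linear T \<and> (\<forall>c x. T (c *\<^sub>C x) = c *\<^sub>C T x)"

text \<open>\<open>is_adjoint S T\<close> means \<open>S = T\<^sup>*\<close>; such an \<open>S\<close> is unique.\<close>

definition is_adjoint :: "('a::complex_inner \<Rightarrow> 'a) \<Rightarrow> ('a \<Rightarrow> 'a) \<Rightarrow> bool"
  where "is_adjoint S T \<longleftrightarrow>
    bounded_clinear S \<and> bounded_clinear T \<and> (\<forall>x y. cinner (T x) y = cinner x (S y))"

definition selfadjoint :: "('a::complex_inner \<Rightarrow> 'a) \<Rightarrow> bool"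
  where "selfadjoint T \<longleftrightarrow> is_adjoint T T"

definition normal_operator :: "('a::complex_inner \<Rightarrow> 'a) \<Rightarrow> bool"
  where "normal_operator T \<longleftrightarrow> (\<exists>S. is_adjoint S T \<and> T \<circ> S = S \<circ> T)"

definition positive_operator :: "('a::complex_inner \<Rightarrow> 'a) \<Rightarrow> bool"
  where "positive_operator T \<longleftrightarrow>
    bounded_clinear T \<and> (\<forall>x. cinner (T x) x \<in> \<real> \<and> 0 \<le> Re (cinner (T x) x))"

definition spectrum :: "('a::complex_inner \<Rightarrow> 'a) \<Rightarrow> complex set"
  where "spectrum T = {l. \<not> (\<exists>S. bounded_clinear S \<and>
    (\<forall>x. S (T x - l *\<^sub>C x) = x) \<and> (\<forall>x. T (S x) - l *\<^sub>C S x = x))}"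

text \<open>
  The spectrum is empty only on the zero space; inserting \<open>0\<close> gives the spectral radius \<open>0\<close> there
  and changes nothing on any other space.
\<close>

definition spectral_radius :: "('a::complex_inner \<Rightarrow> 'a) \<Rightarrow> real"
  where "spectral_radius T = Sup (insert 0 (cmod ` spectrum T))"

subsection \<open>Orthogonal projections and the Moore-Penrose inverse\<close>

definition orth_proj :: "'a::complex_inner set \<Rightarrow> 'a \<Rightarrow> 'a"
  where "orth_proj M x = (THE p. p \<in> M \<and> (\<forall>m\<in>M. cinner (x - p) m = 0))"

definition range_proj :: "('a::complex_inner \<Rightarrow> 'a) \<Rightarrow> 'a \<Rightarrow> 'a"
  where "range_proj T = orth_proj (closure (range T))"

definition is_mp_inverse :: "('a::complex_inner \<Rightarrow> 'a) \<Rightarrow> ('a \<Rightarrow> 'a) \<Rightarrow> bool"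
  where "is_mp_inverse U X \<longleftrightarrow>
    bounded_clinear X \<and> U \<circ> X \<circ> U = U \<and> X \<circ> U \<circ> X = X \<and>
    selfadjoint (U \<circ> X) \<and> selfadjoint (X \<circ> U)"

definition mp_inverse :: "('a::complex_inner \<Rightarrow> 'a) \<Rightarrow> 'a \<Rightarrow> 'a"
  where "mp_inverse U = (THE X. is_mp_inverse U X)"

subsection \<open>Proper splittings\<close>

definition proper_splitting ::
    "('a::complex_inner \<Rightarrow> 'a) \<Rightarrow> ('a \<Rightarrow> 'a) \<Rightarrow> ('a \<Rightarrow> 'a) \<Rightarrow> bool"
  where "proper_splitting T U V \<longleftrightarrow>
    bounded_clinear U \<and> bounded_clinear V \<and> (\<forall>x. T x = U x - V x) \<and>
    range U = range T \<and> {x. U x = 0} = {x. T x = 0}"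

definition splitting_converges :: "('a::complex_inner \<Rightarrow> 'a) \<Rightarrow> ('a \<Rightarrow> 'a) \<Rightarrow> bool"
  where "splitting_converges U V \<longleftrightarrow> spectral_radius (mp_inverse U \<circ> V) < 1"

subsection \<open>The projection splitting is a proper splitting\<close>

lemma cinner_eq_0_iff_perp:
  fixes u :: "'a::complex_inner"
  assumes "\<And>m c. m \<in> M \<Longrightarrow> c *\<^sub>C m \<in> M" and "\<And>m. m \<in> M \<Longrightarrow> u \<bullet> m = 0" and "m \<in> M"
  shows "cinner u m = 0"
proof (rule complex_eqI)
  show "Re (cinner u m) = Re 0" using assms by (simp add: Re_cinner)
  have "cinner u (\<i> *\<^sub>C m) = - \<i> * cinner u m"
    using cinner_commute[of u "\<i> *\<^sub>C m"] cinner_commute[of u m] by (simp add: cinner_scaleC_left)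
  moreover have "Re (cinner u (\<i> *\<^sub>C m)) = 0" using assms by (simp add: Re_cinner)
  ultimately show "Im (cinner u m) = Im 0" by simp
qed

lemma minimizer_exists:
  fixes x :: "'a::complex_hilbert"
  assumes M: "closed M" "subspace M"
  shows "\<exists>p\<in>M. \<forall>m\<in>M. norm (x - p) \<le> norm (x - m)"
proof -
  have ne: "M \<noteq> {}" using subspace_0[OF M(2)] by auto
  define d where "d = infdist x M"
  have d: "d \<le> norm (x - m)" if "m \<in> M" for m
    using infdist_le[OF that, of x] by (simp add: d_def dist_norm)
  have d0: "d \<ge> 0" by (simp add: d_def infdist_nonneg)
  have "\<exists>y\<in>M. norm (x - y) < d + inverse (real (Suc n))" for n
  proof (rule ccontr)
    assume "\<not> ?thesis"
    then have "d + inverse (real (Suc n)) \<le> d"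
      unfolding d_def infdist_notempty[OF ne]
      by (intro cINF_greatest ne) (auto simp: dist_norm not_less d_def infdist_notempty[OF ne])
    then show False by simp
  qed
  then obtain y where y: "\<And>n. y n \<in> M" "\<And>n. norm (x - y n) < d + inverse (real (Suc n))"
    by metis
  have par: "(norm (y m - y n))\<^sup>2 \<le> 2 * (norm (x - y m))\<^sup>2 + 2 * (norm (x - y n))\<^sup>2 - 4 * d\<^sup>2" for m n
  proof -
    have mid: "(1/2) *\<^sub>R (y m + y n) \<in> M" using y(1) M(2) by (simp add: subspace_add subspace_scale)
    have "d\<^sup>2 \<le> (norm (x - (1/2) *\<^sub>R (y m + y n)))\<^sup>2" using d[OF mid] d0 by (simp add: power_mono)
    then show ?thesis
      by (simp add: power2_norm_eq_inner inner_diff inner_add inner_commute algebra_simps)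
  qed
  have lim: "(\<lambda>n. norm (x - y n)) \<longlonglongrightarrow> d"
  proof (rule tendsto_sandwich[of "\<lambda>_. d" _ _ "\<lambda>n. d + inverse (real (Suc n))"])
    show "(\<lambda>n. d + inverse (real (Suc n))) \<longlonglongrightarrow> d"
      using tendsto_add[OF tendsto_const LIMSEQ_inverse_real_of_nat, of d] by simp
  qed (use y d in \<open>auto intro!: always_eventually less_imp_le\<close>)
  have "Cauchy y"
  proof (rule metric_CauchyI)
    fix e :: real assume e: "e > 0"
    have "(\<lambda>n. (norm (x - y n))\<^sup>2) \<longlonglongrightarrow> d\<^sup>2" by (intro tendsto_intros lim)
    then have "\<forall>\<^sub>F n in sequentially. (norm (x - y n))\<^sup>2 < d\<^sup>2 + e\<^sup>2 / 4"
      by (rule order_tendstoD) (use e in simp)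
    then obtain N where N: "\<And>n. n \<ge> N \<Longrightarrow> (norm (x - y n))\<^sup>2 < d\<^sup>2 + e\<^sup>2 / 4"
      by (auto simp: eventually_sequentially)
    have "dist (y m) (y n) < e" if "m \<ge> N" "n \<ge> N" for m n
    proof -
      have "(norm (y m - y n))\<^sup>2 < e\<^sup>2" using par[of m n] N[OF that(1)] N[OF that(2)] by linarith
      then show ?thesis using e by (simp add: dist_norm power_less_imp_less_base)
    qed
    then show "\<exists>N. \<forall>m\<ge>N. \<forall>n\<ge>N. dist (y m) (y n) < e" by blast
  qed
  then obtain p where p: "y \<longlonglongrightarrow> p" by (auto simp: Cauchy_convergent_iff convergent_def)
  have "p \<in> M" using closed_sequentially[OF M(1)] y(1) p by blast
  moreover have "(\<lambda>n. norm (x - y n)) \<longlonglongrightarrow> norm (x - p)" by (intro tendsto_intros p)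
  then have "norm (x - p) = d" using LIMSEQ_unique lim by blast
  ultimately show ?thesis using d by auto
qed

lemma orth_proj_unique:
  fixes x :: "'a::complex_inner"
  assumes "subspace M" "p \<in> M" "\<forall>m\<in>M. cinner (x - p) m = 0" "q \<in> M" "\<forall>m\<in>M. cinner (x - q) m = 0"
  shows "p = q"
proof -
  have m: "p - q \<in> M" using assms by (simp add: subspace_diff)
  have "(x - p) \<bullet> (p - q) = 0" "(x - q) \<bullet> (p - q) = 0"
    using assms m by (auto simp flip: Re_cinner)
  then have "(p - q) \<bullet> (p - q) = 0" by (simp add: inner_diff_left)
  then show ?thesis by simp
qed

lemma orth_proj_props:
  fixes x :: "'a::complex_hilbert"
  assumes M: "closed M" "subspace M" "\<And>m c. m \<in> M \<Longrightarrow> c *\<^sub>C m \<in> M"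
  shows "orth_proj M x \<in> M" "\<forall>m\<in>M. cinner (x - orth_proj M x) m = 0"
proof -
  obtain p where p: "p \<in> M" "\<And>m. m \<in> M \<Longrightarrow> norm (x - p) \<le> norm (x - m)"
    using minimizer_exists[OF M(1,2)] by blast
  have "(x - p) \<bullet> m = 0" if m: "m \<in> M" for m
  proof (cases "m = 0")
    case False
    define t where "t = ((x - p) \<bullet> m) / (m \<bullet> m)"
    have "p + t *\<^sub>R m \<in> M" using p m M(2) by (simp add: subspace_add subspace_scale)
    from p(2)[OF this] have "(x - p) \<bullet> (x - p) \<le> (x - (p + t *\<^sub>R m)) \<bullet> (x - (p + t *\<^sub>R m))"
      by (simp add: norm_le)
    also have "\<dots> = (x - p) \<bullet> (x - p) - 2 * t * ((x - p) \<bullet> m) + t * t * (m \<bullet> m)"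
      by (simp add: inner_diff inner_add inner_commute algebra_simps)
    also have "t * t * (m \<bullet> m) = t * ((x - p) \<bullet> m)" using False by (simp add: t_def)
    finally have "t * ((x - p) \<bullet> m) \<le> 0" by simp
    then have "((x - p) \<bullet> m)\<^sup>2 / (m \<bullet> m) \<le> 0" by (simp add: t_def power2_eq_square)
    moreover have "m \<bullet> m > 0" using False by simp
    ultimately have "((x - p) \<bullet> m)\<^sup>2 \<le> 0" by (simp add: divide_le_0_iff)
    then show ?thesis by simp
  qed simp
  then have "\<forall>m\<in>M. cinner (x - p) m = 0" using cinner_eq_0_iff_perp[of M "x - p"] M(3) by blast
  then have p': "p \<in> M \<and> (\<forall>m\<in>M. cinner (x - p) m = 0)" using p(1) by simp
  have "orth_proj M x \<in> M \<and> (\<forall>m\<in>M. cinner (x - orth_proj M x) m = 0)"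
    unfolding orth_proj_def
  proof (rule theI)
    show "q = p" if "q \<in> M \<and> (\<forall>m\<in>M. cinner (x - q) m = 0)" for q
      using orth_proj_unique[OF M(2), of q x p] that p' by simp
  qed (rule p')
  then show "orth_proj M x \<in> M" "\<forall>m\<in>M. cinner (x - orth_proj M x) m = 0" by auto
qed

lemma orth_proj_eqI:
  fixes x :: "'a::complex_hilbert"
  assumes "closed M" "subspace M" "\<And>m c. m \<in> M \<Longrightarrow> c *\<^sub>C m \<in> M"
    and "p \<in> M" "\<forall>m\<in>M. cinner (x - p) m = 0"
  shows "orth_proj M x = p"
  using orth_proj_unique[OF assms(2)] orth_proj_props[OF assms(1-3)] assms(4,5) by blast

lemma bounded_clinear_orth_proj:
  fixes M :: "'a::complex_hilbert set"
  assumes M: "closed M" "subspace M" "\<And>m c. m \<in> M \<Longrightarrow> c *\<^sub>C m \<in> M"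
  shows "bounded_clinear (orth_proj M)"
proof -
  note P = orth_proj_props[OF M] and E = orth_proj_eqI[OF M]
  have scale: "orth_proj M (c *\<^sub>C x) = c *\<^sub>C orth_proj M x" for c x
  proof (rule E)
    have "c *\<^sub>C x - c *\<^sub>C orth_proj M x = c *\<^sub>C (x - orth_proj M x)"
      using scaleC_add_right[of c "x - orth_proj M x" "orth_proj M x"] by simp
    then show "\<forall>m\<in>M. cinner (c *\<^sub>C x - c *\<^sub>C orth_proj M x) m = 0"
      using P(2)[of x] by (simp add: cinner_scaleC_left)
  qed (use M P in auto)
  have add: "orth_proj M (x + y) = orth_proj M x + orth_proj M y" for x y
  proof (rule E)
    have "x + y - (orth_proj M x + orth_proj M y) = (x - orth_proj M x) + (y - orth_proj M y)" by simp
    then have "cinner (x + y - (orth_proj M x + orth_proj M y)) m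
        = cinner (x - orth_proj M x) m + cinner (y - orth_proj M y) m" for m
      by (metis cinner_add_left)
    then show "\<forall>m\<in>M. cinner (x + y - (orth_proj M x + orth_proj M y)) m = 0"
      using P(2)[of x] P(2)[of y] by simp
  qed (use M P in \<open>auto simp: subspace_add\<close>)
  have "norm (orth_proj M x) \<le> norm x * 1" for x
  proof -
    let ?p = "orth_proj M x"
    have "(x - ?p) \<bullet> ?p = 0" using P(2)[of x] P(1)[of x] by (auto simp flip: Re_cinner)
    then have "?p \<bullet> ?p = x \<bullet> ?p" by (simp add: inner_diff_left)
    also have "\<dots> \<le> norm x * norm ?p" by (rule norm_cauchy_schwarz)
    finally have "norm ?p * norm ?p \<le> norm x * norm ?p"
      by (simp only: power2_norm_eq_inner[symmetric] power2_eq_square)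
    then show ?thesis by (cases "?p = 0") auto
  qed
  then have "bounded_linear (orth_proj M)"
    using add scale[of "complex_of_real _"]
    by (intro bounded_linear_intro[where K = 1]) (auto simp: scaleC_of_real)
  then show ?thesis using scale by (simp add: bounded_clinear_def)
qed

lemma selfadjoint_imp_normal: "selfadjoint T \<Longrightarrow> normal_operator T"
  unfolding selfadjoint_def normal_operator_def by blast

lemma projection_splitting_proper:
  fixes T :: "'a::complex_hilbert \<Rightarrow> 'a"
  assumes "normal_operator T" and cl: "closed (range T)"
  shows "proper_splitting T (range_proj T) (\<lambda>x. range_proj T x - T x)"
proof -
  obtain S where adj: "\<And>x y. cinner (T x) y = cinner x (S y)" and comm: "\<And>x. T (S x) = S (T x)"
    and T: "bounded_clinear T" and S: "bounded_clinear S"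
    using assms(1) unfolding normal_operator_def is_adjoint_def by (auto simp: fun_eq_iff)
  have lT: "linear T" and lS: "linear S"
    using T S by (auto simp: bounded_clinear_def bounded_linear.linear)
  have sub: "subspace (range T)" using linear_subspace_image[OF lT subspace_UNIV] .
  have sc: "c *\<^sub>C m \<in> range T" if "m \<in> range T" for m c
    using that T by (auto simp: bounded_clinear_def) (metis rangeI)
  let ?P = "orth_proj (range T)"
  note P = orth_proj_props[OF cl sub sc] and E = orth_proj_eqI[OF cl sub sc]
  have PT: "range_proj T = ?P" using cl by (simp add: range_proj_def closure_closed)
  have bP: "bounded_clinear ?P" by (rule bounded_clinear_orth_proj[OF cl sub sc])
  have c0: "cinner 0 z = 0" for z :: 'a using cinner_add_left[of 0 0 z] by simp
  have ran: "range ?P = range T"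
  proof
    show "range T \<subseteq> range ?P"
    proof
      fix m assume "m \<in> range T"
      then have "?P m = m" by (intro E) (auto simp: c0)
      then show "m \<in> range ?P" by (metis rangeI)
    qed
  qed (use P in auto)
  have nrm: "T x \<bullet> T x = S x \<bullet> S x" for x
  proof -
    have "cinner (T x) (T x) = cinner x (T (S x))" by (simp add: adj comm)
    also have "\<dots> = cnj (cinner (T (S x)) x)" by (rule cinner_commute)
    also have "\<dots> = cnj (cinner (S x) (S x))" by (simp add: adj)
    finally have "Re (cinner (T x) (T x)) = Re (cinner (S x) (S x))" by simp
    then show ?thesis by (simp only: Re_cinner)
  qed
  have ker: "?P x = 0 \<longleftrightarrow> T x = 0" for x
  proof
    assume "?P x = 0"
    then have "cinner x (T (S x)) = 0" using P(2)[of x] by auto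
    then have "cinner (T x) (T x) = 0" by (simp add: adj comm)
    then have "T x \<bullet> T x = 0" by (simp flip: Re_cinner)
    then show "T x = 0" by simp
  next
    assume "T x = 0"
    then have "S x = 0" using nrm[of x] by simp
    then have "cinner (T y) x = 0" for y
      using adj[of y x] c0 cinner_commute[of y 0] by simp
    then have "cinner x (T y) = 0" for y using cinner_commute[of x "T y"] by simp
    then show "?P x = 0" using sub by (intro E) (auto simp: subspace_0)
  qed
  have "c *\<^sub>C (x - y) = c *\<^sub>C x - c *\<^sub>C y" for c and x y :: 'a
    using scaleC_add_right[of c "x - y" y] by simp
  then have "bounded_clinear (\<lambda>x. ?P x - T x)"
    using bP T by (simp add: bounded_clinear_def bounded_linear_sub)
  then show ?thesis
    using T bP ran ker by (simp add: proper_splitting_def PT)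
qed

end

theory Submission
  imports Defs
begin

text \<open>
  Let \<open>P\<close> be the projection onto the range of \<open>T\<close>.  Since \<open>P\<close> is its own Moore-Penrose inverse and
  \<open>P T = T\<close>, the iteration operator is the selfadjoint \<open>W = P - T\<close>.  If \<open>\<langle>T x, x\<rangle> < 0\<close>, then
  \<open>y = P x\<close> satisfies \<open>\<langle>T y, y\<rangle> = \<langle>T x, x\<rangle>\<close>, whence \<open>\<langle>W y, y\<rangle> > \<parallel>y\<parallel>\<^sup>2\<close>.  The supremum of the
  numerical range of \<open>W\<close> therefore exceeds \<open>1\<close>, and it belongs to the spectrum of \<open>W\<close>.
\<close>

section \<open>Complex inner product spaces\<close>

lemma scaleC_diff_right: "c *\<^sub>C (x - y) = c *\<^sub>C x - c *\<^sub>C (y::'a::complex_inner)"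
  using scaleC_add_right[of c "x - y" y] by simp

lemma norm_scaleC: "norm (c *\<^sub>C x) = cmod c * norm (x::'a::complex_inner)"
proof -
  have "cinner (c *\<^sub>C x) (c *\<^sub>C x) = c * (cnj c * cinner x x)"
    using cinner_commute[of x "c *\<^sub>C x"] cinner_commute[of x x] by (simp add: cinner_scaleC_left)
  also have "\<dots> = complex_of_real ((cmod c)\<^sup>2) * cinner x x"
    by (simp only: complex_norm_square mult.assoc)
  finally have "Re (cinner (c *\<^sub>C x) (c *\<^sub>C x)) = (cmod c)\<^sup>2 * Re (cinner x x)"
    by simp
  then have "(norm (c *\<^sub>C x))\<^sup>2 = (cmod c * norm x)\<^sup>2"
    by (simp only: Re_cinner power2_norm_eq_inner power_mult_distrib)
  then show ?thesis
    by (simp add: power2_eq_iff_nonneg)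
qed

lemma selfadjoint_inner: "selfadjoint T \<Longrightarrow> T x \<bullet> y = x \<bullet> T y"
  unfolding selfadjoint_def is_adjoint_def by (metis Re_cinner)

text \<open>The imaginary part of \<open>cinner x y\<close> is the real part of
  \<open>cinner (- \<i> *\<^sub>C x) y\<close>, so for a complex linear operator symmetry in the
  real inner product is enough.\<close>

lemma selfadjointI:
  assumes T: "bounded_clinear T" and sym: "\<And>x y. T x \<bullet> y = x \<bullet> T y"
  shows "selfadjoint T"
proof -
  have Im: "Im (cinner x y) = Re (cinner (- \<i> *\<^sub>C x) y)" for x y :: 'a
    by (simp add: cinner_scaleC_left)
  have "cinner (T x) y = cinner x (T y)" for x y
  proof (rule complex_eqI)
    have "T (- \<i> *\<^sub>C x) = - \<i> *\<^sub>C T x" using T by (simp add: bounded_clinear_def)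
    then show "Im (cinner (T x) y) = Im (cinner x (T y))"
      unfolding Im Re_cinner by (metis sym)
  qed (simp add: Re_cinner sym)
  then show ?thesis using T by (simp add: selfadjoint_def is_adjoint_def)
qed

text \<open>The quadratic form of a selfadjoint operator is real, so positivity can fail only
  through its sign.\<close>

lemma not_positive_selfadjointE:
  assumes "selfadjoint T" "\<not> positive_operator T"
  obtains x where "T x \<bullet> x < 0"
proof -
  have T: "bounded_clinear T" and adj: "\<And>x. cinner (T x) x = cinner x (T x)"
    using assms(1) unfolding selfadjoint_def is_adjoint_def by auto
  have "cinner (T x) x \<in> \<real>" for x
    using adj[of x] cinner_commute[of x "T x"] by (simp add: Reals_cnj_iff)
  then show thesis
    using assms(2) T that by (auto simp: positive_operator_def Re_cinner not_le)
qed

section \<open>The spectrum\<close>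

text \<open>The lower bound makes \<open>A\<close> injective, so identities for \<open>S\<close> can
  be checked after applying \<open>A\<close>; the same bound, read at \<open>S x\<close>, bounds
  \<open>S\<close> by \<open>inverse e\<close>.\<close>

lemma bounded_clinear_inverse:
  assumes A: "bounded_clinear A" and inv: "\<And>y. A (S y) = y"
    and e: "e > 0" and low: "\<And>x. e * norm x \<le> norm (A x)"
  shows "bounded_clinear S" and "S (A x) = x"
proof -
  interpret A: bounded_linear A using A by (simp add: bounded_clinear_def)
  have AC: "A (c *\<^sub>C x) = c *\<^sub>C A x" for c x using A by (simp add: bounded_clinear_def)
  have inj: "x = y" if "A x = A y" for x y
    using low[of "x - y"] e that by (simp add: A.diff mult_le_0_iff)
  show "S (A x) = x" by (rule inj) (simp add: inv)
  have C: "S (c *\<^sub>C y) = c *\<^sub>C S y" for c y by (rule inj) (simp add: inv AC)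
  have "bounded_linear S"
  proof (rule bounded_linear_intro)
    show "S (x + y) = S x + S y" for x y by (rule inj) (simp add: inv A.add)
    show "S (r *\<^sub>R x) = r *\<^sub>R S x" for r x using C[of "complex_of_real r"] by (simp add: scaleC_of_real)
    show "norm (S x) \<le> norm x * inverse e" for x
      using low[of "S x"] e by (simp add: inv field_simps)
  qed
  with C show "bounded_clinear S" by (simp add: bounded_clinear_def)
qed

lemma bounded_clinear_diff_scaleC:
  assumes "bounded_clinear (W :: 'a::complex_inner \<Rightarrow> 'a)"
  shows "bounded_clinear (\<lambda>x. W x - l *\<^sub>C x)"
proof -
  have comm: "l *\<^sub>C c *\<^sub>C x = c *\<^sub>C l *\<^sub>C x" for c and x :: 'a
    by (simp add: scaleC_scaleC mult.commute)
  have "bounded_linear (\<lambda>x::'a. l *\<^sub>C x)"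
    by (rule bounded_linear_intro[where K = "cmod l"])
      (simp_all add: scaleC_add_right comm norm_scaleC flip: scaleC_of_real)
  with assms show ?thesis
    by (simp add: bounded_clinear_def bounded_linear_sub scaleC_diff_right comm)
qed

text \<open>If \<open>cmod l\<close> exceeds \<open>onorm W\<close>, then \<open>W - l\<close> is
  onto and bounded below by their difference, hence boundedly invertible.\<close>

lemma spectrum_le_onorm:
  fixes W :: "'a::complex_hilbert \<Rightarrow> 'a"
  assumes W: "bounded_clinear W" and l: "l \<in> spectrum W"
  shows "cmod l \<le> onorm W"
proof (rule ccontr)
  assume "\<not> cmod l \<le> onorm W"
  then have less: "onorm W < cmod l" by simp
  interpret W: bounded_linear W using W by (simp add: bounded_clinear_def)
  have K: "norm (W x) \<le> onorm W * norm x" for x by (rule onorm[OF W.bounded_linear_axioms])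
  have pos: "0 \<le> onorm W" by (rule onorm_pos_le[OF W.bounded_linear_axioms])
  then have l0: "l \<noteq> 0" using less by auto
  let ?A = "\<lambda>x. W x - l *\<^sub>C x"
  \<comment> \<open>A solution of \<open>W x - l x = y\<close> is a fixed point of a contraction.\<close>
  have "\<exists>x. ?A x = y" for y
  proof -
    have "\<exists>!x. inverse l *\<^sub>C (W x - y) = x"
    proof (rule banach_fix_type[where c = "onorm W / cmod l"])
      show "0 \<le> onorm W / cmod l" using pos by simp
      show "onorm W / cmod l < 1" using less l0 by simp
      show "\<forall>x z. dist (inverse l *\<^sub>C (W x - y)) (inverse l *\<^sub>C (W z - y))
          \<le> onorm W / cmod l * dist x z"
      proof (intro allI)
        fix x z
        have "norm (inverse l *\<^sub>C (W x - y) - inverse l *\<^sub>C (W z - y)) = norm (W (x - z)) / cmod l"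
          by (simp add: norm_scaleC norm_inverse divide_inverse_commute W.diff flip: scaleC_diff_right)
        also have "\<dots> \<le> onorm W * norm (x - z) / cmod l"
          by (intro divide_right_mono K) simp
        finally show "dist (inverse l *\<^sub>C (W x - y)) (inverse l *\<^sub>C (W z - y))
            \<le> onorm W / cmod l * dist x z" by (simp add: dist_norm)
      qed
    qed
    then obtain x where "inverse l *\<^sub>C (W x - y) = x" by blast
    then have "l *\<^sub>C x = l *\<^sub>C inverse l *\<^sub>C (W x - y)" by simp
    also have "\<dots> = complex_of_real 1 *\<^sub>C (W x - y)" using l0 by (simp add: scaleC_scaleC)
    also have "\<dots> = W x - y" by (simp only: scaleC_of_real scaleR_one)
    finally show ?thesis by (intro exI[of _ x]) simp
  qed
  then obtain S where S: "\<And>y. ?A (S y) = y" by metis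
  have low: "(cmod l - onorm W) * norm x \<le> norm (?A x)" for x
    using K[of x] norm_triangle_ineq2[of "l *\<^sub>C x" "W x"]
    by (simp add: norm_scaleC norm_minus_commute algebra_simps)
  have "bounded_clinear S" "\<And>x. S (?A x) = x"
    using bounded_clinear_inverse[OF bounded_clinear_diff_scaleC[OF W] S _ low] less by auto
  then show False using l S unfolding spectrum_def by blast
qed

text \<open>The operator norm bounds the set under \<open>Sup\<close>, so each of its elements lies
  below the supremum.\<close>

lemma spectrum_le_spectral_radius:
  fixes W :: "'a::complex_hilbert \<Rightarrow> 'a"
  assumes "bounded_clinear W" "l \<in> spectrum W"
  shows "cmod l \<le> spectral_radius W"
  unfolding spectral_radius_def
proof (rule cSup_upper)
  show "bdd_above (insert 0 (cmod ` spectrum W))"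
    using spectrum_le_onorm[OF assms(1)] by (auto intro: bdd_aboveI[where M = "onorm W"])
qed (use assms(2) in simp)

text \<open>Where the quadratic form is small, \<open>A x\<close> itself is small; this turns a
  bounded inverse into a gap in the numerical range.\<close>

lemma positive_symmetric_norm_bound:
  fixes A :: "'a::real_inner \<Rightarrow> 'a"
  assumes A: "linear A" and sym: "\<And>x y. A x \<bullet> y = x \<bullet> A y" and pos: "\<And>x. 0 \<le> A x \<bullet> x"
    and K: "K > 0" "\<And>x. norm (A x) \<le> K * norm x"
  shows "(norm (A x))\<^sup>2 \<le> K * (A x \<bullet> x)"
proof -
  interpret A: linear A by (rule A)
  let ?z = "A x"
  have "A ?z \<bullet> ?z \<le> norm (A ?z) * norm ?z" by (rule norm_cauchy_schwarz)
  also have "\<dots> \<le> K * norm ?z * norm ?z" by (intro mult_right_mono K) simp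
  finally have z: "A ?z \<bullet> ?z \<le> K * (?z \<bullet> ?z)"
    by (simp add: mult.assoc flip: power2_eq_square power2_norm_eq_inner)
  \<comment> \<open>Positivity at \<open>K x - A x\<close> replaces the Cauchy-Schwarz inequality for \<open>\<langle>A x, y\<rangle>\<close>.\<close>
  have "0 \<le> A (K *\<^sub>R x - ?z) \<bullet> (K *\<^sub>R x - ?z)" by (rule pos)
  also have "\<dots> = K * (K * (?z \<bullet> x)) - 2 * K * (?z \<bullet> ?z) + A ?z \<bullet> ?z"
    by (simp add: A.diff A.scale inner_diff sym[of ?z x] algebra_simps)
  also have "\<dots> \<le> K * (K * (?z \<bullet> x) - ?z \<bullet> ?z)" using z by (simp add: algebra_simps)
  finally have "0 \<le> K * (?z \<bullet> x) - ?z \<bullet> ?z" using K(1) by (simp add: zero_le_mult_iff)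
  then show ?thesis by (simp add: power2_norm_eq_inner)
qed

lemma bdd_above_numerical_range:
  assumes "bounded_linear (W :: 'a::real_inner \<Rightarrow> 'a)"
  shows "bdd_above ((\<lambda>x. W x \<bullet> x) ` sphere 0 1)"
proof (rule bdd_aboveI2)
  fix x :: 'a assume "x \<in> sphere 0 1"
  then show "W x \<bullet> x \<le> onorm W"
    using onorm[OF assms, of x] norm_cauchy_schwarz[of "W x" x] by simp
qed

text \<open>Both sides are homogeneous of degree 2 in \<open>x\<close>, so it suffices to normalise
  \<open>x\<close>.\<close>

lemma inner_le_numerical_sup:
  assumes "bounded_linear (W :: 'a::real_inner \<Rightarrow> 'a)"
  shows "W x \<bullet> x \<le> (SUP u\<in>sphere 0 1. W u \<bullet> u) * (norm x)\<^sup>2"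
proof (cases "x = 0")
  case False
  interpret W: bounded_linear W by (rule assms)
  have "W (x /\<^sub>R norm x) \<bullet> (x /\<^sub>R norm x) \<le> (SUP u\<in>sphere 0 1. W u \<bullet> u)"
    by (rule cSUP_upper[OF _ bdd_above_numerical_range[OF assms]]) (use False in simp)
  then show ?thesis using False by (simp add: W.scaleR field_simps power2_eq_square)
qed simp

text \<open>Let \<open>m\<close> be the supremum. A bounded inverse of \<open>W - m\<close> would
  keep the form of \<open>m - W\<close> away from 0 on the unit sphere, so the form of
  \<open>W\<close> would stay below \<open>m\<close> by a fixed amount.\<close>

lemma numerical_sup_in_spectrum:
  fixes W :: "'a::complex_inner \<Rightarrow> 'a"
  assumes W: "selfadjoint W" and ne: "sphere (0::'a) 1 \<noteq> {}"
  shows "complex_of_real (SUP x\<in>sphere 0 1. W x \<bullet> x) \<in> spectrum W"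
proof (rule ccontr)
  define m where "m = (SUP x\<in>sphere 0 1. W x \<bullet> x)"
  define A where "A = (\<lambda>x. m *\<^sub>R x - W x)"
  have blW: "bounded_linear W"
    using W by (simp add: selfadjoint_def is_adjoint_def bounded_clinear_def)
  note sup = inner_le_numerical_sup[OF blW, folded m_def]
  assume "\<not> ?thesis"
  then obtain S where S: "bounded_clinear S" "\<And>x. S (W x - m *\<^sub>R x) = x"
    unfolding spectrum_def by (auto simp: scaleC_of_real m_def)
  then interpret S: bounded_linear S by (simp add: bounded_clinear_def)
  have SA: "S (A x) = - x" for x
    using S(2)[of x] S.neg[of "A x"] by (metis A_def minus_diff_eq minus_minus)
  interpret A: bounded_linear A
    unfolding A_def by (intro bounded_linear_sub bounded_linear_scaleR_right blW)
  obtain K where K: "K > 0" "\<And>x. norm (A x) \<le> K * norm x"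
    using A.pos_bounded by (auto simp: mult.commute)
  obtain C where C: "C > 0" "\<And>x. norm (S x) \<le> C * norm x"
    using S.pos_bounded by (auto simp: mult.commute)
  have bound: "(norm (A x))\<^sup>2 \<le> K * (A x \<bullet> x)" for x
  proof (rule positive_symmetric_norm_bound[OF A.linear _ _ K])
    show "A x \<bullet> y = x \<bullet> A y" for x y
      by (simp add: A_def inner_diff selfadjoint_inner[OF W])
    show "0 \<le> A x \<bullet> x" for x
      using sup[of x] by (simp add: A_def inner_diff power2_norm_eq_inner)
  qed
  have "W x \<bullet> x \<le> m - 1 / (C\<^sup>2 * K)" if x: "x \<in> sphere 0 1" for x
  proof -
    \<comment> \<open>Since \<open>S (A x) = - x\<close> has norm 1, \<open>A x\<close> cannot be
      short; \<open>bound\<close> carries this over to the quadratic form.\<close>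
    have "1 \<le> C * norm (A x)" using C(2)[of "A x"] x by (simp add: SA)
    then have "1 \<le> (C * norm (A x))\<^sup>2" by (simp add: one_le_power)
    also have "\<dots> \<le> C\<^sup>2 * (K * (A x \<bullet> x))"
      unfolding power_mult_distrib by (intro mult_left_mono bound) simp
    also have "A x \<bullet> x = m - W x \<bullet> x"
      using x by (simp add: A_def inner_diff flip: power2_norm_eq_inner)
    finally show ?thesis using C(1) K(1) by (simp add: field_simps)
  qed
  then have "m \<le> m - 1 / (C\<^sup>2 * K)" unfolding m_def by (intro cSUP_least ne) auto
  then show False using C(1) K(1) by (simp add: field_simps)
qed

lemma spectral_radius_gt_numerical:
  fixes W :: "'a::complex_hilbert \<Rightarrow> 'a"
  assumes W: "selfadjoint W" and y: "c * (norm y)\<^sup>2 < W y \<bullet> y"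
  shows "c < spectral_radius W"
proof -
  define m where "m = (SUP x\<in>sphere 0 1. W x \<bullet> x)"
  have bc: "bounded_clinear W" using W by (simp add: selfadjoint_def is_adjoint_def)
  then have bl: "bounded_linear W" by (simp add: bounded_clinear_def)
  \<comment> \<open>The strict inequality fails at 0, so the space is nonzero and its unit sphere is
    inhabited.\<close>
  have "y \<noteq> 0" using y by auto
  then have "y /\<^sub>R norm y \<in> sphere 0 1" by simp
  then have "complex_of_real m \<in> spectrum W"
    unfolding m_def by (intro numerical_sup_in_spectrum W) blast
  then have "\<bar>m\<bar> \<le> spectral_radius W" using spectrum_le_spectral_radius[OF bc] by fastforce
  moreover have "c * (norm y)\<^sup>2 < m * (norm y)\<^sup>2"
    using y inner_le_numerical_sup[OF bl, of y] by (simp add: m_def)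
  then have "c < m" by (simp add: mult_less_cancel_right)
  ultimately show ?thesis by simp
qed

section \<open>Projections and the Moore-Penrose inverse\<close>

text \<open>The adjoint of \<open>E F\<close> is \<open>F E\<close>, so a selfadjoint product equals
  the product in reverse order.\<close>

lemma selfadjoint_comp_commute:
  assumes "selfadjoint E" "selfadjoint F" "selfadjoint (E \<circ> F)"
  shows "E (F x) = F (E x)"
proof -
  have "E (F x) \<bullet> z = F (E x) \<bullet> z" for z
    using assms[THEN selfadjoint_inner] by (metis comp_apply)
  then show ?thesis using vector_eq_rdot by blast
qed

text \<open>Once \<open>U X = U Y\<close> and \<open>X U = Y U\<close>, the chain
  \<open>X = X U X = X U Y = Y U Y = Y\<close> finishes.\<close>

lemma is_mp_inverse_unique:
  assumes X: "is_mp_inverse U X" and Y: "is_mp_inverse U Y"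
  shows "X = Y"
proof -
  have sa: "selfadjoint (U \<circ> X)" "selfadjoint (X \<circ> U)" "selfadjoint (U \<circ> Y)" "selfadjoint (Y \<circ> U)"
    and U: "\<And>x. U (X (U x)) = U x" "\<And>x. U (Y (U x)) = U x"
    and XY: "\<And>x. X (U (X x)) = X x" "\<And>x. Y (U (Y x)) = Y x"
    using X Y by (auto simp: is_mp_inverse_def fun_eq_iff)
  \<comment> \<open>Both products are selfadjoint, so their factors commute; in reverse order they
    reduce to \<open>U X\<close> and \<open>Y U\<close>.\<close>
  have "(U \<circ> X) \<circ> (U \<circ> Y) = U \<circ> Y" "(X \<circ> U) \<circ> (Y \<circ> U) = X \<circ> U"
    by (simp_all add: U fun_eq_iff)
  then have UX: "U (X x) = U (Y x)" and XU: "X (U x) = Y (U x)" for x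
    using selfadjoint_comp_commute[of "U \<circ> X" "U \<circ> Y" x]
      selfadjoint_comp_commute[of "X \<circ> U" "Y \<circ> U" x] sa by (simp_all add: U)
  show ?thesis
  proof
    fix x
    have "X x = X (U (Y x))" using UX XY by metis
    then show "X x = Y x" by (simp add: XU XY)
  qed
qed

lemma mp_inverse_eqI: "is_mp_inverse U X \<Longrightarrow> mp_inverse U = X"
  unfolding mp_inverse_def by (intro the_equality is_mp_inverse_unique)

lemma mp_inverse_projection:
  assumes P: "selfadjoint P" and idem: "\<And>x. P (P x) = P x"
  shows "mp_inverse P = P"
proof (rule mp_inverse_eqI)
  have "P \<circ> P = P" using idem by (simp add: fun_eq_iff)
  then show "is_mp_inverse P P"
    using P by (simp add: is_mp_inverse_def selfadjoint_def is_adjoint_def)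
qed

text \<open>The residual of \<open>x\<close> is orthogonal to \<open>M\<close>, so the inner product
  of \<open>x\<close> with the projection of \<open>y\<close> equals that of the two projections,
  which is symmetric in \<open>x\<close> and \<open>y\<close>.\<close>

lemma
  fixes M :: "'a::complex_hilbert set"
  assumes M: "closed M" "subspace M" "\<And>m c. m \<in> M \<Longrightarrow> c *\<^sub>C m \<in> M"
  shows orth_proj_ident: "\<And>m. m \<in> M \<Longrightarrow> orth_proj M m = m"
    and selfadjoint_orth_proj: "selfadjoint (orth_proj M)"
proof -
  let ?P = "orth_proj M"
  note P = orth_proj_props[OF M]
  have perp: "(x - ?P x) \<bullet> ?P y = 0" for x y
    using P(1)[of y] P(2)[of x] by (simp flip: Re_cinner)
  then have "x \<bullet> ?P y = ?P x \<bullet> ?P y" for x y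
    by (simp add: inner_diff_left)
  then have "?P x \<bullet> y = x \<bullet> ?P y" for x y by (metis inner_commute)
  then show "selfadjoint ?P" by (intro selfadjointI bounded_clinear_orth_proj[OF M])
  have "cinner (0::'a) z = 0" for z using cinner_add_left[of 0 0 z] by simp
  then show "?P m = m" if "m \<in> M" for m
    using that by (intro orth_proj_eqI[OF M]) simp_all
qed

theorem proposition4p8:
  fixes T :: "'a::complex_hilbert \<Rightarrow> 'a"
  assumes "selfadjoint T" and "\<not> positive_operator T" and "closed (range T)"
  shows "\<not> splitting_converges (range_proj T) (\<lambda>x. range_proj T x - T x)"
proof -
  let ?P = "range_proj T"
  let ?W = "\<lambda>x. ?P x - T x"
  have T: "bounded_clinear T" using assms(1) by (simp add: selfadjoint_def is_adjoint_def)
  have P_def: "?P = orth_proj (range T)"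
    using assms(3) by (simp add: range_proj_def closure_closed)
  have sub: "subspace (range T)"
    using T by (simp add: bounded_clinear_def bounded_linear.linear linear_subspace_image)
  have sc: "c *\<^sub>C m \<in> range T" if "m \<in> range T" for m c
    using that T by (auto simp: bounded_clinear_def) (metis rangeI)
  note range = assms(3) sub sc
  have P: "selfadjoint ?P" unfolding P_def by (rule selfadjoint_orth_proj[OF range])
  have PT: "?P (T x) = T x" for x unfolding P_def by (rule orth_proj_ident[OF range]) auto
  have PP: "?P (?P x) = ?P x" for x
    unfolding P_def by (intro orth_proj_ident[OF range] orth_proj_props[OF range])
  have "linear ?P"
    using P by (simp add: selfadjoint_def is_adjoint_def bounded_clinear_def bounded_linear.linear)
  then have PW: "mp_inverse ?P \<circ> ?W = ?W"
    by (simp add: mp_inverse_projection[OF P PP] fun_eq_iff linear_diff PP PT)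
  have W: "selfadjoint ?W"
  proof (rule selfadjointI)
    show "bounded_clinear ?W"
      using projection_splitting_proper[OF selfadjoint_imp_normal[OF assms(1)] assms(3)]
      by (simp add: proper_splitting_def)
    show "?W x \<bullet> y = x \<bullet> ?W y" for x y
      using P assms(1) by (simp add: inner_diff selfadjoint_inner)
  qed
  obtain x where x: "T x \<bullet> x < 0" using not_positive_selfadjointE[OF assms(1,2)] .
  \<comment> \<open>The product \<open>P T = T\<close> is selfadjoint, so \<open>P\<close> and
    \<open>T\<close> commute and \<open>T P = T\<close> as well.\<close>
  have "?P \<circ> T = T" by (simp add: PT fun_eq_iff)
  then have "T (?P x) = T x"
    using selfadjoint_comp_commute[OF P assms(1)] assms(1) PT by simp
  then have "T (?P x) \<bullet> ?P x < 0"
    using x selfadjoint_inner[OF P, of "T x" x] by (simp add: PT)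
  \<comment> \<open>On the range of \<open>P\<close> the operator \<open>W\<close> acts as the
    identity minus \<open>T\<close>, so its form at \<open>P x\<close> is the squared norm minus a
    negative number.\<close>
  then have "1 * (norm (?P x))\<^sup>2 < ?W (?P x) \<bullet> ?P x"
    by (simp add: inner_diff PP power2_norm_eq_inner)
  then have "1 < spectral_radius ?W" by (rule spectral_radius_gt_numerical[OF W])
  then show ?thesis by (simp add: splitting_converges_def PW)
qed

end
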